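(* For every integer $n\ge1$, $$t(1,\{2\}^n)=\frac1{2^{2n}}\left(\sum_{r=0}^{n-1}(-1)^r\big(-\zeta(\overline{2r+1})\big)\frac{\pi^{2(n-r)}}{(2(n-r))!}+(-1)^n\,2\,\big(1-2^{-2n-1}\big)\zeta(2n+1)\right).$$
   Context: For integers $k_1,\ldots,k_d\ge1$ with $k_d\ge2$, the multiple $t$ value is $t(k_1,\ldots,k_d)=\sum_{0<n_1<\cdots<n_d}\prod_{i=1}^d(2n_i-1)^{-k_i}$. $\{2\}^n$ is $2$ repeated $n$ times. $\zeta(\overline{m})=\sum_{j\ge1}(-1)^j/j^m$, so that $-\zeta(\overline{1})=\log 2$, and $\zeta(m)=\sum_{j\ge1}1/j^m$. *)

theory Defs
  imports "HOL-Analysis.Analysis"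
begin

definition increasing_tuples :: "nat \<Rightarrow> nat list set" where
  "increasing_tuples d = {ns. length ns = d \<and> (\<forall>m\<in>set ns. 0 < m) \<and> sorted_wrt (<) ns}"

text \<open>
  The terms are positive, so the unordered sum \<^const>\<open>infsum\<close> is the usual multiple series
  whenever the latter converges, i.e. for positive exponents with the last one at least 2.
  The smallest summation variable carries the first exponent.
\<close>
definition multiple_t :: "nat list \<Rightarrow> real" where
  "multiple_t ks =
     (\<Sum>\<^sub>\<infinity>ns\<in>increasing_tuples (length ks).
        \<Prod>i<length ks. 1 / (2 * real (ns ! i) - 1) ^ (ks ! i))"

text \<open>Both series start at 1, hence the shift by \<^const>\<open>Suc\<close>.\<close>
definition zeta_val :: "nat \<Rightarrow> real" where
  "zeta_val m = (\<Sum>j. 1 / real (Suc j) ^ m)"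

text \<open>For \<open>m = 1\<close> this converges only conditionally, so the summation order matters.\<close>
definition zeta_bar :: "nat \<Rightarrow> real" where
  "zeta_bar m = (\<Sum>j. (-1) ^ Suc j / real (Suc j) ^ m)"

end

theory Submission
  imports Defs
begin

text \<open>
  Write \<open>W n p\<close> for the integral of \<open>cos x ^ p * x ^ (2 n) / (2 n)!\<close> over \<open>[0, \<pi>/2]\<close>. Integrating by parts
  twice shows that \<open>W n (2 k - 1) / W 0 (2 k - 1)\<close> telescopes in \<open>k\<close>, and hence equals the tail
  of \<open>t({2}^n)\<close> over indices greater than \<open>k\<close>. As \<open>1 / ((2 k - 1) * W 0 (2 k - 1))\<close> is a coefficient
  of the binomial series of \<open>(1 - u) powr (-1/2)\<close>, summing over the smallest index \<open>k\<close> gives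
  \<open>t(1,{2}^n)\<close> as the integral of \<open>x ^ (2 n) / (2 n)! * cot x\<close> over \<open>[0, \<pi>/2]\<close>. Finally
  \<open>cot x = 2 * (\<Sum>k\<le>N. sin (2 k x)) + cos ((2 N + 1) x) / sin x\<close>; the contribution of the last term
  vanishes as \<open>N\<close> grows (Riemann-Lebesgue), and the sine moments of \<open>x ^ (2 n)\<close> are elementary.
\<close>

section \<open>Elementary bounds and derivatives\<close>

text \<open>A crude Jordan inequality: it keeps \<open>x / sin x\<close> at most 2 up to the
  singularity at 0, and every bound near 0 below rests on it.\<close>

lemma le_two_sin:
  fixes x :: real
  assumes "0 \<le> x" "x \<le> pi / 2"
  shows "x \<le> 2 * sin x"
proof -
  define y where "y = x / 2"
  have y: "0 \<le> y" "y \<le> pi / 2" using assms pi_gt_zero unfolding y_def by linarith+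
  \<comment> \<open>\<open>sin y \<ge> y cos y\<close> at the half angle, where \<open>cos\<^sup>2 y \<ge> 1/2\<close>\<close>
  have "0 * cos 0 - sin 0 \<ge> y * cos y - sin y"
  proof (rule DERIV_nonpos_imp_nonincreasing[OF y(1)])
    fix t assume "0 \<le> t" "t \<le> y"
    hence "0 \<le> t * sin t" using y pi_gt_zero by (intro mult_nonneg_nonneg sin_ge_zero) linarith+
    thus "\<exists>d. ((\<lambda>t. t * cos t - sin t) has_real_derivative d) (at t) \<and> d \<le> 0"
      by (intro exI[of _ "- (t * sin t)"]) (auto intro!: derivative_eq_intros)
  qed
  hence s: "y * cos y \<le> sin y" by simp
  have c: "0 \<le> cos y" "0 \<le> cos x" using y assms by (auto intro!: cos_ge_zero)
  have "cos x = 2 * (cos y)\<^sup>2 - 1" using cos_double_cos[of y] by (simp add: y_def)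
  hence "1 \<le> 2 * (cos y)\<^sup>2" using c by linarith
  hence "y * 1 \<le> y * (2 * (cos y)\<^sup>2)" using y by (intro mult_left_mono)
  also have "\<dots> = 2 * ((y * cos y) * cos y)" by (simp add: power2_eq_square)
  also have "\<dots> \<le> 2 * (sin y * cos y)" using s c by (intro mult_left_mono mult_right_mono) auto
  also have "\<dots> = sin x" using sin_double[of y] by (simp add: y_def)
  finally show ?thesis by (simp add: y_def)
qed

text \<open>With the factorial divided out, differentiation is a pure index shift, so integrating by
  parts twice leaves no factors depending on the degree.\<close>

lemma has_real_derivative_power_Suc_div_fact:
  "((\<lambda>x::real. x ^ Suc m / fact (Suc m)) has_real_derivative x ^ m / fact m) (at x within S)"
proof -
  have "((\<lambda>x::real. x ^ Suc m / fact (Suc m)) has_real_derivative (1 + real m) * x ^ m / fact (Suc m)) (at x within S)"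
    using DERIV_power[OF DERIV_ident, where n = "Suc m" and x = x and s = S] by (intro DERIV_cdivide) simp
  moreover have "(1 + real m) * x ^ m / fact (Suc m) = x ^ m / fact m" by simp
  ultimately show ?thesis by simp
qed

section \<open>Cosine moments and the Wallis recurrence\<close>

definition cos_moment :: "nat \<Rightarrow> nat \<Rightarrow> real" where
  "cos_moment n p = integral {0..pi / 2} (\<lambda>x. cos x ^ p * (x ^ (2 * n) / fact (2 * n)))"

lemma cos_moment_has_integral:
  "((\<lambda>x. cos x ^ p * (x ^ (2 * n) / fact (2 * n))) has_integral cos_moment n p) {0..pi / 2}"
  unfolding cos_moment_def
  by (intro integrable_integral integrable_continuous_real continuous_intros) auto

lemma cos_moment_0_has_integral: "((\<lambda>x. cos x ^ p) has_integral cos_moment 0 p) {0..pi / 2}"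
  using cos_moment_has_integral[of p 0] by simp

lemma cos_moment_nonneg: "0 \<le> cos_moment n p"
  by (rule has_integral_nonneg[OF cos_moment_has_integral])
     (auto intro!: cos_ge_zero zero_le_power mult_nonneg_nonneg divide_nonneg_nonneg)

text \<open>Green's identity for \<open>u = cos ^ (p + 2)\<close> and
  \<open>e = x ^ (2 n + 2) / (2 n + 2)!\<close>: the second derivative of \<open>u\<close> is
  \<open>(p + 2) (p + 1) cos ^ p - (p + 2)^2 cos ^ (p + 2)\<close>, and that of \<open>e\<close> is
  the weight of level \<open>n\<close>.\<close>

lemma cos_moment_rec_Suc:
  "real (p + 2) * real (p + 1) * cos_moment (Suc n) p - (real (p + 2))\<^sup>2 * cos_moment (Suc n) (p + 2)
     = cos_moment n (p + 2)"
proof -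
  define e where "e m x = x ^ m / fact m" for m and x :: real
  have de: "(e (Suc m) has_real_derivative e m x) (at x within S)" for m x S
    unfolding e_def by (rule has_real_derivative_power_Suc_div_fact)
  \<comment> \<open>This is \<open>e u' - e' u\<close>. It vanishes at 0 because of the powers of
    \<open>x\<close>, and at \<open>pi / 2\<close> because of the cosine.\<close>
  define H where "H x = - (e (2*n+2) x * (real (p + 2) * cos x ^ (p + 1) * sin x)) - e (2*n+1) x * cos x ^ (p + 2)" for x
  define h where "h x = real (p + 2) * real (p + 1) * (cos x ^ p * e (2*n+2) x)
      - (real (p + 2))\<^sup>2 * (cos x ^ (p + 2) * e (2*n+2) x) - cos x ^ (p + 2) * e (2*n) x" for x
  have "(H has_real_derivative h x) (at x within {0..pi/2})" for x
  proof -
    have 1: "(e (2*n+2) has_real_derivative e (2*n+1) x) (at x within {0..pi/2})"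
      and 2: "(e (2*n+1) has_real_derivative e (2*n) x) (at x within {0..pi/2})"
      using de[of "2*n+1"] de[of "2*n"] by auto
    \<comment> \<open>Pythagoras with a spare factor \<open>z\<close>, in the right-nested form that
      products take after sorting by \<open>algebra_simps\<close>.\<close>
    have s: "sin x * (sin x * z) = z - cos x * (cos x * z)" for z
      using sin_cos_squared_add[of x] by (simp add: power2_eq_square flip: mult.assoc left_diff_distrib) algebra
    show ?thesis unfolding H_def h_def
      apply (rule derivative_eq_intros 1 2 refl)+
      apply (simp add: algebra_simps power2_eq_square s)
      done
  qed
  hence I: "(h has_integral (H (pi/2) - H 0)) {0..pi/2}"
    by (intro fundamental_theorem_of_calculus) (auto simp: has_real_derivative_iff_has_vector_derivative)
  have H0: "H (pi/2) = 0" "H 0 = 0" by (simp_all add: H_def e_def)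
  have J: "(h has_integral (real (p + 2) * real (p + 1) * cos_moment (Suc n) p
     - (real (p + 2))\<^sup>2 * cos_moment (Suc n) (p + 2) - cos_moment n (p + 2))) {0..pi/2}"
    using cos_moment_has_integral[of _ "Suc n"] cos_moment_has_integral[of _ n]
    unfolding h_def e_def by (intro has_integral_diff has_integral_mult_right) (simp_all only: mult_Suc_right add.commute)
  show ?thesis using has_integral_unique[OF I J] H0 by simp
qed

text \<open>The Wallis recurrence: the derivative of \<open>cos ^ (p + 1) * sin\<close> has integral
  0, as this product vanishes at both ends.\<close>

lemma cos_moment_0_rec:
  "real (p + 2) * cos_moment 0 (p + 2) = real (p + 1) * cos_moment 0 p"
proof -
  define H where "H x = cos x ^ (p + 1) * sin x" for x :: real
  define h where "h x = real (p + 2) * cos x ^ (p + 2) - real (p + 1) * cos x ^ p" for x :: real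
  have "(H has_real_derivative h x) (at x within {0..pi/2})" for x
  proof -
    have s: "sin x * (sin x * z) = z - cos x * (cos x * z)" for z
      using sin_cos_squared_add[of x] by (simp add: power2_eq_square flip: mult.assoc left_diff_distrib) algebra
    show ?thesis unfolding H_def h_def
      apply (rule derivative_eq_intros refl)+
      apply (simp add: algebra_simps power2_eq_square s)
      done
  qed
  hence I: "(h has_integral (H (pi/2) - H 0)) {0..pi/2}"
    by (intro fundamental_theorem_of_calculus) (auto simp: has_real_derivative_iff_has_vector_derivative)
  have H0: "H (pi/2) = 0" "H 0 = 0" by (simp_all add: H_def)
  have J: "(h has_integral (real (p + 2) * cos_moment 0 (p + 2) - real (p + 1) * cos_moment 0 p)) {0..pi/2}"
    unfolding h_def by (intro has_integral_diff has_integral_mult_right cos_moment_0_has_integral)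
  show ?thesis using has_integral_unique[OF I J] H0 by simp
qed

lemma cos_moment_0_1: "cos_moment 0 1 = 1"
proof -
  have "((\<lambda>x. cos x ^ 1 * (x ^ (2 * 0) / fact (2 * 0))) has_integral (sin (pi/2) - sin 0)) {0..pi/2}"
    by (intro fundamental_theorem_of_calculus)
       (auto simp: has_real_derivative_iff_has_vector_derivative[symmetric] intro!: derivative_eq_intros)
  with cos_moment_has_integral[of 1 0] show ?thesis by (auto dest: has_integral_unique)
qed

lemma cos_moment_0_odd_pos: "0 < cos_moment 0 (2 * j + 1)"
proof (induction j)
  case 0
  show ?case using cos_moment_0_1 by simp
next
  case (Suc j)
  have "0 < real (2 * j + 1 + 2) * cos_moment 0 (2 * j + 1 + 2)"
    unfolding cos_moment_0_rec by (intro mult_pos_pos Suc.IH) simp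
  hence "0 < cos_moment 0 (2 * j + 1 + 2)" 
    by (rule zero_less_mult_pos) simp
  thus ?case by simp
qed

section \<open>Tails of the series for t({2}^n)\<close>

text \<open>
  \<open>tail_t n k\<close> is the tail of \<open>t({2}^n)\<close> over indices greater than \<open>k + 1\<close> (not \<open>k\<close>); the shift
  avoids the truncated subtraction in the exponent \<open>2 k - 1\<close>.
\<close>
definition tail_t :: "nat \<Rightarrow> nat \<Rightarrow> real" where
  "tail_t n k = cos_moment n (2 * k + 1) / cos_moment 0 (2 * k + 1)"

lemma tail_t_nonneg: "0 \<le> tail_t n k"
  by (simp add: tail_t_def cos_moment_nonneg)

lemma tail_t_0: "tail_t 0 k = 1"
  using cos_moment_0_odd_pos[of k] by (simp add: tail_t_def)

text \<open>This is \<open>cos_moment_rec_Suc\<close> at \<open>p = 2 k + 1\<close>, divided by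
  \<open>(p + 2)^2 * cos_moment 0 (p + 2)\<close>.\<close>

lemma tail_t_diff:
  "tail_t (Suc n) k - tail_t (Suc n) (Suc k) = tail_t n (Suc k) / (2 * real k + 3)\<^sup>2"
proof -
  define p where "p = 2 * k + 1"
  have S: "2 * Suc k + 1 = p + 2" by (simp add: p_def)
  have pos: "0 < cos_moment 0 p" "0 < cos_moment 0 (p + 2)"
    using cos_moment_0_odd_pos[of k] cos_moment_0_odd_pos[of "Suc k"] by (auto simp: p_def)
  define a b where "a = real (p + 2)" and "b = real (p + 1)"
  have ab: "0 < a" "0 < b" by (simp_all add: a_def b_def)
  have r: "a * cos_moment 0 (p + 2) = b * cos_moment 0 p"
    unfolding a_def b_def by (rule cos_moment_0_rec)
  \<comment> \<open>The Wallis recurrence brings both quotients of the difference over the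
    denominator \<open>cos_moment 0 (p + 2)\<close>.\<close>
  have q: "cos_moment (Suc n) p / cos_moment 0 p = b * cos_moment (Suc n) p / (a * cos_moment 0 (p + 2))"
    using ab unfolding r by simp
  have k: "2 * real k + 3 = a" by (simp add: p_def a_def)
  have "b * w / (a * v) - w' / v = (a * b * w - a\<^sup>2 * w') / v / a\<^sup>2" if "0 < v" for w w' v
    using that ab by (simp add: field_simps power2_eq_square)
  thus ?thesis
    unfolding tail_t_def S p_def[symmetric] q k cos_moment_rec_Suc[of p n, symmetric]
    unfolding a_def[symmetric] b_def[symmetric] using pos by simp
qed

text \<open>On the interval \<open>x \<le> 2\<close> and \<open>x \<le> 2 sin x\<close>, so
  \<open>x ^ (2 n + 2)\<close> is at most \<open>4 ^ n * 4 * (sin x)^2\<close>, and the squared sine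
  turns the bound into a difference of Wallis integrals.\<close>

lemma cos_moment_le:
  "cos_moment (Suc n) p \<le> 4 ^ Suc n * (cos_moment 0 p - cos_moment 0 (p + 2))"
proof (rule has_integral_le[OF cos_moment_has_integral])
  show "((\<lambda>x. 4 ^ Suc n * (cos x ^ p * (x ^ (2 * 0) / fact (2 * 0)) - cos x ^ (p + 2) * (x ^ (2 * 0) / fact (2 * 0))))
     has_integral 4 ^ Suc n * (cos_moment 0 p - cos_moment 0 (p + 2))) {0..pi / 2}"
    by (intro has_integral_mult_right has_integral_diff cos_moment_has_integral)
next
  fix x assume x: "x \<in> {0..pi/2}"
  have x2: "x \<le> 2" using x pi_half_less_two by auto
  have "x ^ (2 * Suc n) / fact (2 * Suc n) \<le> x ^ (2 * Suc n)"
    using x divide_left_mono[of 1 "fact (2 * Suc n)" "x ^ (2 * Suc n)"] by (simp add: fact_ge_1 del: fact_Suc)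
  also have "\<dots> = x\<^sup>2 * x ^ (2 * n)" by (simp add: power2_eq_square)
  also have "\<dots> \<le> (2 * sin x)\<^sup>2 * 2 ^ (2 * n)"
    using x x2 le_two_sin[of x] by (intro mult_mono power_mono) auto
  also have "\<dots> = 4 ^ Suc n * (1 - cos x ^ 2)"
    by (simp add: sin_squared_eq power_mult power_mult_distrib)
  finally have "cos x ^ p * (x ^ (2 * Suc n) / fact (2 * Suc n)) \<le> cos x ^ p * (4 ^ Suc n * (1 - cos x ^ 2))"
    using x by (intro mult_left_mono) (auto intro!: cos_ge_zero zero_le_power)
  thus "cos x ^ p * (x ^ (2 * Suc n) / fact (2 * Suc n)) \<le> 
      4 ^ Suc n * (cos x ^ p * (x ^ (2 * 0) / fact (2 * 0)) - cos x ^ (p + 2) * (x ^ (2 * 0) / fact (2 * 0)))"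
    by (simp add: algebra_simps power_add power2_eq_square)
qed

text \<open>By the Wallis recurrence the difference in \<open>cos_moment_le\<close> is the fraction
  \<open>1 / (2 k + 3)\<close> of \<open>cos_moment 0 (2 k + 1)\<close>, which gives decay of order
  \<open>1 / k\<close>.\<close>

lemma tail_t_tendsto_0: "tail_t (Suc n) \<longlonglongrightarrow> 0"
proof (rule tendsto_sandwich[of "\<lambda>_. 0" _ _ "\<lambda>k. 4 ^ Suc n / real (2 * k + 3)"])
  show "\<forall>\<^sub>F k in sequentially. tail_t (Suc n) k \<le> 4 ^ Suc n / real (2 * k + 3)"
  proof (rule always_eventually, rule allI)
    fix k
    define w where "w = cos_moment 0 (2 * k + 1)"
    have w: "0 < w" unfolding w_def by (rule cos_moment_0_odd_pos)
    have "real (2 * k + 3) * cos_moment 0 (2 * k + 1 + 2) = real (2 * k + 2) * w"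
      using cos_moment_0_rec[of "2 * k + 1"] by (simp add: w_def add.commute)
    hence "w - cos_moment 0 (2 * k + 1 + 2) = w / real (2 * k + 3)"
      by (simp add: field_simps)
    with cos_moment_le[of n "2 * k + 1"] 
    have "cos_moment (Suc n) (2 * k + 1) \<le> 4 ^ Suc n * (w / real (2 * k + 3))" by (simp add: w_def)
    hence "cos_moment (Suc n) (2 * k + 1) / w \<le> 4 ^ Suc n * (w / real (2 * k + 3)) / w"
      using w by (intro divide_right_mono) auto
    thus "tail_t (Suc n) k \<le> 4 ^ Suc n / real (2 * k + 3)" using w by (simp add: tail_t_def w_def)
  qed
  show "(\<lambda>k. 4 ^ Suc n / real (2 * k + 3)) \<longlonglongrightarrow> 0"
    by (rule tendsto_divide_0[OF tendsto_const] filterlim_at_top_imp_at_infinity filterlim_compose[OF filterlim_real_sequentially] filterlim_subseq)+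
       (auto simp: strict_mono_def)
qed (auto simp: tail_t_nonneg)

lemma tail_t_sums:
  "(\<lambda>j. tail_t n (k + Suc j) / (2 * real (k + Suc j) + 1)\<^sup>2) sums tail_t (Suc n) k"
proof -
  have "(\<lambda>j. tail_t (Suc n) (j + k)) \<longlonglongrightarrow> 0"
    by (rule LIMSEQ_ignore_initial_segment[OF tail_t_tendsto_0])
  from telescope_sums'[OF this] show ?thesis
    by (simp add: tail_t_diff add_ac)
qed

section \<open>Multiple sums as iterated series\<close>

text \<open>The lower bound is a parameter because removing the smallest entry \<open>m\<close>
  leaves a tuple with all entries above \<open>m\<close>.\<close>

definition increasing_tuples_above :: "nat \<Rightarrow> nat \<Rightarrow> nat list set" where
  "increasing_tuples_above d k = {ns \<in> increasing_tuples d. \<forall>m\<in>set ns. k < m}"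

lemma increasing_tuples_above_0: "increasing_tuples_above d 0 = increasing_tuples d"
  by (auto simp: increasing_tuples_above_def increasing_tuples_def)

text \<open>Fubini after splitting off the smallest entry: for nonnegative terms, convergence of the
  iterated sum already gives unconditional summability.\<close>

lemma has_sum_increasing_tuples_Suc:
  fixes f :: "nat list \<Rightarrow> real"
  assumes "\<And>ns. ns \<in> increasing_tuples_above (Suc d) k \<Longrightarrow> 0 \<le> f ns"
    and inner: "\<And>m. k < m \<Longrightarrow> ((\<lambda>ns. f (m # ns)) has_sum g m) (increasing_tuples_above d m)"
    and outer: "(\<lambda>j. g (k + Suc j)) sums S"
  shows "(f has_sum S) (increasing_tuples_above (Suc d) k)"
proof -
  have inj: "m # ns \<in> increasing_tuples_above (Suc d) k"
    if "k < m" "ns \<in> increasing_tuples_above d m" for m ns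
    using that by (auto simp: increasing_tuples_above_def increasing_tuples_def)
  have g: "0 \<le> g m" if "k < m" for m
    by (rule has_sum_nonneg[OF inner[OF that]]) (auto intro!: assms(1) inj that)
  have "((\<lambda>j. g (k + Suc j)) has_sum S) UNIV"
    by (rule sums_nonneg_imp_has_sum[OF outer]) (auto intro!: g)
  moreover have "bij_betw (\<lambda>j. k + Suc j) UNIV {k<..}"
    by (rule bij_betwI[of _ _ _ "\<lambda>m. m - Suc k"]) auto
  ultimately have G: "(g has_sum S) {k<..}"
    by (subst (asm) has_sum_reindex_bij_betw) 
  have "((\<lambda>(m, ns). f (m # ns)) has_sum S) (SIGMA m:{k<..}. increasing_tuples_above d m)"
  proof (rule has_sum_SigmaI)
    show "(\<lambda>(m, ns). f (m # ns)) summable_on (SIGMA m:{k<..}. increasing_tuples_above d m)"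
      by (rule summable_on_SigmaI[where g = g])
         (use inner G in \<open>auto intro!: assms(1) inj simp: summable_on_def\<close>)
  qed (use inner G in auto)
  also have "?this \<longleftrightarrow> (f has_sum S) (increasing_tuples_above (Suc d) k)"
    by (rule has_sum_reindex_bij_witness[of _ "\<lambda>ns. (hd ns, tl ns)" "\<lambda>(m, ns). m # ns"])
       (auto simp: increasing_tuples_above_def increasing_tuples_def length_Suc_conv)
  finally show ?thesis .
qed

text \<open>Peeling off the smallest index \<open>m\<close> leaves the same sum with one factor
  less, and the outer series is the telescoped one of \<open>tail_t_sums\<close>.\<close>

lemma has_sum_tail_t:
  "((\<lambda>ns. \<Prod>i<n. 1 / (2 * real (ns ! i) - 1)\<^sup>2) has_sum tail_t n k) (increasing_tuples_above n (Suc k))"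
proof (induction n arbitrary: k)
  case 0
  have "increasing_tuples_above 0 (Suc k) = {[]}"
    by (auto simp: increasing_tuples_above_def increasing_tuples_def)
  thus ?case by (simp add: tail_t_0 has_sum_finiteI)
next
  case (Suc n)
  show ?case
  proof (rule has_sum_increasing_tuples_Suc)
    \<comment> \<open>Tuples above \<open>m\<close> belong to \<open>tail_t n (m - 1)\<close>, by
      the index shift in \<open>tail_t\<close>; the subtraction is exact since \<open>m\<close> is
      positive.\<close>
    show "((\<lambda>ns. \<Prod>i<Suc n. 1 / (2 * real ((m # ns) ! i) - 1)\<^sup>2)
        has_sum 1 / (2 * real m - 1)\<^sup>2 * tail_t n (m - 1)) (increasing_tuples_above n m)"
      if "Suc k < m" for m
      unfolding prod.lessThan_Suc_shift nth_Cons_0 nth_Cons_Suc using Suc.IH[of "m - 1"] that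
      by (intro has_sum_cmult_right) simp
    show "(\<lambda>j. 1 / (2 * real (Suc k + Suc j) - 1)\<^sup>2 * tail_t n (Suc k + Suc j - 1)) sums tail_t (Suc n) k"
      using tail_t_sums[of n k] by (simp add: algebra_simps)
  qed (rule prod_nonneg, simp)
qed

text \<open>Only the smallest index \<open>m = j + 1\<close> carries exponent 1, so it contributes
  \<open>1 / (2 j + 1)\<close> and the inner sum over the twos is a tail.\<close>

lemma multiple_t_1_twos_eqI:
  assumes "(\<lambda>j. tail_t n j / (2 * real j + 1)) sums S"
  shows "multiple_t (1 # replicate n 2) = S"
proof -
  define f :: "nat list \<Rightarrow> real" where
    "f ns = (\<Prod>i<Suc n. 1 / (2 * real (ns ! i) - 1) ^ ((1 # replicate n 2) ! i))" for ns
  have "(f has_sum S) (increasing_tuples_above (Suc n) 0)"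
  proof (rule has_sum_increasing_tuples_Suc)
    fix ns assume ns: "ns \<in> increasing_tuples_above (Suc n) 0"
    have "1 \<le> real (ns ! i)" if "i < Suc n" for i
    proof -
      have "ns ! i \<in> set ns" using ns that by (auto simp: increasing_tuples_above_def increasing_tuples_def)
      with ns have "0 < ns ! i" by (auto simp: increasing_tuples_above_def)
      thus ?thesis by simp
    qed
    thus "0 \<le> f ns" unfolding f_def
      by (intro prod_nonneg ballI divide_nonneg_nonneg zero_le_power) force+
  next
    fix m :: nat assume "0 < m"
    hence "((\<lambda>ns. \<Prod>i<n. 1 / (2 * real (ns ! i) - 1)\<^sup>2) has_sum tail_t n (m - 1)) (increasing_tuples_above n m)"
      using has_sum_tail_t[of n "m - 1"] by simp
    hence "((\<lambda>ns. 1 / (2 * real m - 1) * (\<Prod>i<n. 1 / (2 * real (ns ! i) - 1)\<^sup>2))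
        has_sum 1 / (2 * real m - 1) * tail_t n (m - 1)) (increasing_tuples_above n m)"
      by (rule has_sum_cmult_right)
    moreover have "f (m # ns) = 1 / (2 * real m - 1) * (\<Prod>i<n. 1 / (2 * real (ns ! i) - 1)\<^sup>2)" for ns
      unfolding f_def prod.lessThan_Suc_shift by simp
    ultimately show "((\<lambda>ns. f (m # ns)) has_sum 1 / (2 * real m - 1) * tail_t n (m - 1)) (increasing_tuples_above n m)"
      by simp
  next
    show "(\<lambda>j. 1 / (2 * real (0 + Suc j) - 1) * tail_t n (0 + Suc j - 1)) sums S"
      using assms by (simp add: algebra_simps)
  qed
  hence "infsum f (increasing_tuples (Suc n)) = S"
    by (simp add: increasing_tuples_above_0 infsumI)
  thus ?thesis by (simp add: multiple_t_def f_def[abs_def])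
qed

section \<open>Binomial series and the cotangent integral\<close>

text \<open>Both sides are the central binomial coefficient \<open>(2 j choose j) / 4 ^ j\<close>:
  they start at 1 and have the common ratio \<open>(2 j + 1) / (2 j + 2)\<close>.\<close>

lemma cos_moment_0_odd_eq:
  "1 / ((2 * real j + 1) * cos_moment 0 (2 * j + 1)) = (-1) ^ j * ((-1/2) gchoose j)"
proof (induction j)
  case 0
  show ?case using cos_moment_0_1 by simp
next
  case (Suc j)
  define w where "w = cos_moment 0 (2 * j + 1)"
  have w: "0 < w" unfolding w_def by (rule cos_moment_0_odd_pos)
  have "(2 * real (Suc j) + 1) * cos_moment 0 (2 * Suc j + 1) = (2 * real j + 2) * w"
    using cos_moment_0_rec[of "2 * j + 1"] by (simp add: w_def algebra_simps)
  hence "1 / ((2 * real (Suc j) + 1) * cos_moment 0 (2 * Suc j + 1)) = 1 / ((2 * real j + 2) * w)"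
    by simp
  also have "\<dots> = 1 / ((2 * real j + 1) * w) * ((2 * real j + 1) / (2 * real j + 2))"
    by (simp add: add_pos_nonneg divide_simps)
  also have "\<dots> = (-1) ^ j * ((-1/2) gchoose j) * ((2 * real j + 1) / (2 * real j + 2))"
    using Suc.IH by (simp add: w_def)
  also have "\<dots> = (-1) ^ Suc j * ((-1/2) gchoose Suc j)"
  proof -
    have g: "((-1/2) gchoose Suc j) = ((-1/2) gchoose j) * ((-1/2 - real j) / (real j + 1))"
      using gbinomial_absorption'[of "Suc j" "-1/2::real"] gbinomial_mult_1[of "-1/2::real" j]
      by (simp add: field_simps)
    show ?thesis unfolding g by (simp add: field_simps)
  qed
  finally show ?case .
qed

text \<open>The binomial series of \<open>(1 - u) powr (-1/2)\<close> at
  \<open>u = (cos x)^2\<close> has the value \<open>1 / sin x\<close>; multiply by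
  \<open>cos x\<close>. Positivity of \<open>x\<close> ensures \<open>u < 1\<close>.\<close>

lemma cot_sums:
  fixes x :: real
  assumes "0 < x" "x \<le> pi / 2"
  shows "(\<lambda>j. 1 / ((2 * real j + 1) * cos_moment 0 (2 * j + 1)) * cos x ^ (2 * j + 1)) sums cot x"
proof -
  have s: "0 < sin x" using assms pi_gt_zero by (intro sin_gt_zero) linarith+
  have "(cos x)\<^sup>2 < 1" using s sin_cos_squared_add[of x] by (smt (verit) zero_less_power)
  hence "(\<lambda>j. ((-1/2) gchoose j) * (- (cos x)\<^sup>2) ^ j) sums (1 + - (cos x)\<^sup>2) powr (-1/2)"
    by (intro gen_binomial_real) simp
  moreover have "(1 + - (cos x)\<^sup>2) powr (-1/2) = 1 / sin x"
  proof -
    have "1 + - (cos x)\<^sup>2 = (sin x)\<^sup>2" by (simp add: sin_squared_eq)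
    moreover have "((sin x)\<^sup>2) powr (1/2) = sin x" using s by (simp add: powr_half_sqrt)
    ultimately show ?thesis using powr_minus_divide[of "(sin x)\<^sup>2" "1/2"] by simp
  qed
  ultimately have "(\<lambda>j. ((-1/2) gchoose j) * (- (cos x)\<^sup>2) ^ j) sums (1 / sin x)"
    by (rule subst[rotated])
  hence "(\<lambda>j. ((-1/2) gchoose j) * (- (cos x)\<^sup>2) ^ j * cos x) sums (1 / sin x * cos x)"
    by (rule sums_mult2)
  moreover have "(- (cos x)\<^sup>2) ^ j = (-1) ^ j * cos x ^ (2 * j)" for j
    by (subst power_minus) (simp add: power_mult)
  ultimately show ?thesis
    unfolding cos_moment_0_odd_eq by (simp add: cot_def mult_ac)
qed

lemma power_Suc_div_sin_le:
  fixes x :: real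
  assumes "0 \<le> x" "x \<le> pi / 2"
  shows "x ^ Suc m / sin x \<le> 2 * x ^ m"
proof (cases "x = 0")
  case False
  hence "0 < sin x" using assms pi_gt_zero by (intro sin_gt_zero) linarith+
  moreover have "x * x ^ m \<le> 2 * sin x * x ^ m"
    using le_two_sin[of x] assms by (intro mult_right_mono) auto
  ultimately show ?thesis by (simp add: field_simps)
qed simp

text \<open>Termwise integration of the cotangent series against the weight. At least one 2 is
  present, so the power of \<open>x\<close> tames the pole of \<open>cot\<close> at 0.\<close>

lemma multiple_t_1_twos_eq_integral_cot:
  "multiple_t (1 # replicate (Suc n) 2) = integral {0..pi/2} (\<lambda>x. x ^ (2 * Suc n) / fact (2 * Suc n) * cot x)"
proof (rule multiple_t_1_twos_eqI)
  define w where "w j = 1 / ((2 * real j + 1) * cos_moment 0 (2 * j + 1))" for j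
  define e :: "real \<Rightarrow> real" where "e x = x ^ (2 * Suc n) / fact (2 * Suc n)" for x
  define f where "f k x = (\<Sum>j<k. w j * (cos x ^ (2 * j + 1) * e x))" for k x
  have w: "0 \<le> w j" for j
    unfolding w_def using cos_moment_0_odd_pos[of j] by simp
  have fI: "(f k has_integral (\<Sum>j<k. w j * cos_moment (Suc n) (2 * j + 1))) {0..pi/2}" for k
    unfolding f_def e_def by (intro has_integral_sum has_integral_mult_right cos_moment_has_integral) auto
  have sums: "(\<lambda>j. w j * cos x ^ (2 * j + 1)) sums cot x" if "0 < x" "x \<le> pi / 2" for x
    using cot_sums[OF that] by (simp add: w_def)
  \<comment> \<open>This settles the endpoint 0, which \<open>cot_sums\<close> excludes.\<close>
  have e0: "e 0 = 0" by (simp add: e_def)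
  have f_eq: "f k x = (\<Sum>j<k. w j * cos x ^ (2 * j + 1)) * e x" for k x
    by (simp only: f_def sum_distrib_right mult.assoc)
  have "(\<lambda>k. integral {0..pi/2} (f k)) \<longlonglongrightarrow> integral {0..pi/2} (\<lambda>x. e x * cot x)"
  \<comment> \<open>The constant comes from
    \<open>x ^ (2 n + 2) / sin x \<le> 2 * x ^ (2 n + 1)\<close> and
    \<open>x \<le> 2\<close>.\<close>
  proof (rule dominated_convergence(2)[where h = "\<lambda>_. 2 * 2 ^ (2 * n + 1)"])
    show "f k integrable_on {0..pi/2}" for k using fI by blast
    show "norm (f k x) \<le> 2 * 2 ^ (2 * n + 1)" if x: "x \<in> {0..pi/2}" for k x
    proof (cases "x = 0")
      case False
      with x have x': "0 < x" "x \<le> pi / 2" by auto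
      have s: "0 < sin x" using x' pi_gt_zero by (intro sin_gt_zero) linarith+
      have c: "0 \<le> cos x" using x' by (intro cos_ge_zero) auto
      have e: "0 \<le> e x" using x' by (simp add: e_def)
      have nn: "0 \<le> w j * cos x ^ (2 * j + 1)" for j using w c by (intro mult_nonneg_nonneg zero_le_power)
      \<comment> \<open>The terms are nonnegative, so partial sums stay below the limit.\<close>
      have "(\<Sum>j<k. w j * cos x ^ (2 * j + 1)) \<le> cot x"
        using sum_le_suminf[OF sums_summable[OF sums[OF x']], of "{..<k}"] nn sums_unique[OF sums[OF x']] by simp
      hence "f k x \<le> cot x * e x" unfolding f_eq by (intro mult_right_mono e)
      also have "\<dots> \<le> 1 / sin x * x ^ Suc (2 * n + 1)"
      proof (rule mult_mono)
        show "cot x \<le> 1 / sin x" using s by (simp add: cot_def divide_right_mono)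
        show "e x \<le> x ^ Suc (2 * n + 1)"
          using x' divide_left_mono[of 1 "fact (2 * Suc n)" "x ^ (2 * Suc n)"]
          by (simp add: e_def fact_ge_1 del: fact_Suc)
      qed (use s e in auto)
      also have "\<dots> \<le> 2 * x ^ (2 * n + 1)" using power_Suc_div_sin_le[of x "2 * n + 1"] x' by simp
      also have "\<dots> \<le> 2 * 2 ^ (2 * n + 1)"
        using x' pi_half_less_two by (intro mult_left_mono power_mono) linarith+
      finally have "f k x \<le> 2 * 2 ^ (2 * n + 1)" .
      moreover have "0 \<le> f k x" unfolding f_eq by (intro mult_nonneg_nonneg sum_nonneg nn e)
      ultimately show ?thesis by simp
    qed (simp add: f_eq e0)
    show "(\<lambda>k. f k x) \<longlonglongrightarrow> e x * cot x" if x: "x \<in> {0..pi/2}" for x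
    proof (cases "x = 0")
      case False
      with x have "(\<lambda>k. \<Sum>j<k. w j * cos x ^ (2 * j + 1)) \<longlonglongrightarrow> cot x"
        using sums[of x] by (simp add: sums_def)
      thus ?thesis unfolding f_eq by (subst mult.commute) (intro tendsto_intros)
    qed (simp add: f_eq e0)
  qed auto
  moreover have "integral {0..pi/2} (f k) = (\<Sum>j<k. w j * cos_moment (Suc n) (2 * j + 1))" for k
    by (rule integral_unique[OF fI])
  ultimately have "(\<lambda>j. w j * cos_moment (Suc n) (2 * j + 1)) sums integral {0..pi/2} (\<lambda>x. e x * cot x)"
    by (simp add: sums_def)
  thus "(\<lambda>j. tail_t (Suc n) j / (2 * real j + 1)) sums
    integral {0..pi/2} (\<lambda>x. x ^ (2 * Suc n) / fact (2 * Suc n) * cot x)"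
    by (simp add: w_def e_def tail_t_def mult_ac del: fact_Suc)
qed

section \<open>Finite sine expansion of the cotangent and its remainder\<close>

text \<open>Multiplied by \<open>sin x\<close>, each summand becomes
  \<open>cos ((2 k - 1) x) - cos ((2 k + 1) x)\<close> with \<open>k\<close> its frequency index,
  and the sum telescopes.\<close>

lemma cot_eq_sum_sin:
  fixes x :: real
  assumes "sin x \<noteq> 0"
  shows "cot x = (\<Sum>k<N. 2 * sin (2 * real (Suc k) * x)) + cos ((2 * real N + 1) * x) / sin x"
proof -
  have "sin x * (\<Sum>k<N. 2 * sin (2 * real (Suc k) * x)) = cos x - cos ((2 * real N + 1) * x)"
  proof (induction N)
    case (Suc N)
    have "sin x * (2 * sin (2 * real (Suc N) * x)) = cos ((2 * real N + 1) * x) - cos ((2 * real (Suc N) + 1) * x)"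
      using sin_times_sin[of "2 * real (Suc N) * x" x] by (simp add: algebra_simps)
    with Suc show ?case by (simp add: distrib_left)
  qed simp
  with assms show ?thesis by (simp add: cot_def field_simps)
qed

text \<open>The limit at 0 is 0, since the quotient is at most \<open>2 * x ^ (m + 1)\<close>; this
  agrees with the value that division by zero assigns there.\<close>

lemma continuous_on_power_div_sin:
  "continuous_on {0..pi/2} (\<lambda>x::real. x ^ (m + 2) / sin x)"
  unfolding continuous_on_def
proof
  fix x :: real assume x: "x \<in> {0..pi/2}"
  show "((\<lambda>x. x ^ (m + 2) / sin x) \<longlongrightarrow> x ^ (m + 2) / sin x) (at x within {0..pi/2})"
  proof (cases "x = 0")
    case True
    have "((\<lambda>x::real. 2 * x ^ Suc m) \<longlongrightarrow> 2 * 0 ^ Suc m) (at 0 within {0..pi/2})"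
      by (intro tendsto_intros)
    hence "((\<lambda>x::real. 2 * x ^ Suc m) \<longlongrightarrow> 0) (at 0 within {0..pi/2})" by simp
    moreover have "\<forall>\<^sub>F x in at 0 within {0..pi/2}. norm (x ^ (m + 2) / sin x) \<le> 2 * x ^ Suc m"
      unfolding eventually_at_filter
    proof (intro always_eventually allI impI)
      fix x :: real assume x: "x \<in> {0..pi/2}"
      hence "0 \<le> sin x" using pi_gt_zero by (intro sin_ge_zero) auto
      thus "norm (x ^ (m + 2) / sin x) \<le> 2 * x ^ Suc m"
        using x power_Suc_div_sin_le[of x "Suc m"] by (simp add: abs_mult)
    qed
    ultimately have "((\<lambda>x. x ^ (m + 2) / sin x) \<longlongrightarrow> 0) (at 0 within {0..pi/2})"
      by (rule Lim_null_comparison[rotated])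
    with True show ?thesis by simp
  next
    case False
    hence "sin x \<noteq> 0" using x pi_gt_zero by (intro less_imp_neq[symmetric] sin_gt_zero) auto
    thus ?thesis by (intro tendsto_intros)
  qed
qed

lemma integral_power_div_sin_cos_tendsto_0:
  "(\<lambda>N. integral {0..pi/2} (\<lambda>x. x ^ (m + 2) / sin x * cos ((2 * real N + 1) * x))) \<longlonglongrightarrow> 0"
proof -
  define g where "g x = x ^ (m + 2) / sin x" for x :: real
  define g' where "g' x = (real (m + 2) * x ^ (m + 1) * sin x - x ^ (m + 2) * cos x) / (sin x)\<^sup>2" for x :: real
  \<comment> \<open>Bound for \<open>g'\<close>, obtained from \<open>x / sin x \<le> 2\<close> and
    \<open>x \<le> 2\<close>.\<close>
  define C where "C = (2 * real (m + 2) + 4) * 2 ^ m"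
  have cont: "continuous_on {0..pi/2} g"
    unfolding g_def by (rule continuous_on_power_div_sin)
  have deriv: "(g has_real_derivative g' x) (at x)" if "0 < x" "x < pi / 2" for x
  proof -
    have "sin x \<noteq> 0" using that pi_gt_zero by (intro less_imp_neq[symmetric] sin_gt_zero) auto
    moreover have "((\<lambda>x. x ^ (m + 2)) has_real_derivative real (m + 2) * x ^ (m + 1)) (at x)"
      using DERIV_power[OF DERIV_ident, where n = "m + 2" and x = x and s = UNIV] by simp
    ultimately show ?thesis unfolding g_def g'_def power2_eq_square
      by (intro DERIV_divide DERIV_sin)
  qed
  have g'_bound: "\<bar>g' x\<bar> \<le> C" if x: "x \<in> {0..pi/2}" for x
  proof (cases "x = 0")
    \<comment> \<open>Division by zero makes \<open>g' 0 = 0\<close>, so the bound extends to the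
      closed interval.\<close>
    case True
    thus ?thesis by (simp add: g'_def C_def)
  next
    case False
    with x have x': "0 < x" "x \<le> pi / 2" by auto
    have s: "0 < sin x" using x' pi_gt_zero by (intro sin_gt_zero) linarith+
    have q: "x / sin x \<le> 2" "0 \<le> x / sin x" using power_Suc_div_sin_le[of x 0] x' s by auto
    have "g' x = real (m + 2) * (x / sin x) * x ^ m - (x / sin x)\<^sup>2 * cos x * x ^ m"
      using s by (simp add: g'_def field_simps power2_eq_square)
    also have "\<bar>\<dots>\<bar> \<le> \<bar>real (m + 2) * (x / sin x) * x ^ m\<bar> + \<bar>(x / sin x)\<^sup>2 * cos x * x ^ m\<bar>"
      by (rule abs_triangle_ineq4)
    also have "\<dots> = real (m + 2) * (x / sin x) * x ^ m + (x / sin x)\<^sup>2 * \<bar>cos x\<bar> * x ^ m"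
      using x' s by (simp add: abs_mult)
    also have "\<dots> \<le> real (m + 2) * 2 * 2 ^ m + 2\<^sup>2 * 1 * 2 ^ m"
      using q x' pi_half_less_two
      by (intro add_mono mult_mono power_mono mult_nonneg_nonneg zero_le_power) auto
    also have "\<dots> = C" by (simp add: C_def algebra_simps)
    finally show ?thesis .
  qed
  \<comment> \<open>by parts: \<open>g\<close> has a bounded derivative, so each cosine moment is \<open>O(1/c)\<close>\<close>
  have bound: "\<bar>integral {0..pi/2} (\<lambda>x. g x * cos (c * x))\<bar> \<le> (\<bar>g (pi/2)\<bar> + C * (pi / 2)) / c"
    if c: "0 < c" for c
  proof -
    define J where "J = integral {0..pi/2} (\<lambda>x. g x * cos (c * x))"
    have J: "((\<lambda>x. g x * cos (c * x)) has_integral J) {0..pi/2}"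
      unfolding J_def by (intro integrable_integral integrable_continuous_real continuous_intros cont)
    define F where "F x = g x * (sin (c * x) / c)" for x
    have "((\<lambda>x. g' x * (sin (c * x) / c) + g x * cos (c * x)) has_integral (F (pi/2) - F 0)) {0..pi/2}"
    \<comment> \<open>The derivative of \<open>g\<close> is established only in the open interval;
      continuity covers the endpoints.\<close>
    proof (rule fundamental_theorem_of_calculus_interior)
      show "continuous_on {0..pi/2} F" unfolding F_def using c by (intro continuous_intros cont) auto
      fix x assume "x \<in> {0<..<pi/2}"
      hence d: "(g has_real_derivative g' x) (at x)" by (intro deriv) auto
      show "(F has_vector_derivative g' x * (sin (c * x) / c) + g x * cos (c * x)) (at x)"
        unfolding F_def has_real_derivative_iff_has_vector_derivative[symmetric]
        using c by (auto intro!: derivative_eq_intros d simp: field_simps)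
    qed simp
    from has_integral_diff[OF this J]
    have "((\<lambda>x. g' x * (sin (c * x) / c)) has_integral (F (pi/2) - F 0 - J)) {0..pi/2}" by simp
    hence "norm (F (pi/2) - F 0 - J) \<le> C / c * measure lborel (cbox 0 (pi/2))"
    proof (intro has_integral_bound)
      fix x assume "x \<in> cbox 0 (pi/2)"
      hence "\<bar>g' x\<bar> * \<bar>sin (c * x)\<bar> \<le> C * 1" by (intro mult_mono g'_bound) (auto simp: C_def)
      thus "norm (g' x * (sin (c * x) / c)) \<le> C / c" using c by (simp add: abs_mult divide_right_mono)
    qed (use c in \<open>auto simp: C_def\<close>)
    moreover have "F 0 = 0" by (simp add: F_def)
    moreover have "\<bar>F (pi/2)\<bar> \<le> \<bar>g (pi/2)\<bar> / c"
    proof -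
      have "\<bar>g (pi/2)\<bar> * \<bar>sin (c * (pi/2))\<bar> \<le> \<bar>g (pi/2)\<bar> * 1" by (intro mult_left_mono) auto
      thus ?thesis using c by (simp add: F_def abs_mult divide_right_mono)
    qed
    ultimately have "\<bar>J\<bar> \<le> \<bar>g (pi/2)\<bar> / c + C / c * (pi / 2)" by simp
    thus ?thesis by (simp add: J_def add_divide_distrib)
  qed
  have K: "(\<lambda>N. K / real (2 * N + 1)) \<longlonglongrightarrow> 0" for K
    by (rule tendsto_divide_0[OF tendsto_const] filterlim_at_top_imp_at_infinity filterlim_compose[OF filterlim_real_sequentially] filterlim_subseq)+
       (auto simp: strict_mono_def)
  show ?thesis
  proof (rule Lim_null_comparison)
    show "\<forall>\<^sub>F N in sequentially. norm (integral {0..pi/2} (\<lambda>x. x ^ (m + 2) / sin x * cos ((2 * real N + 1) * x)))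
        \<le> (\<bar>g (pi/2)\<bar> + C * (pi / 2)) / (2 * real N + 1)"
      using bound unfolding g_def by (intro always_eventually allI) (simp add: add_pos_nonneg)
    show "(\<lambda>N. (\<bar>g (pi/2)\<bar> + C * (pi / 2)) / (2 * real N + 1)) \<longlonglongrightarrow> 0"
      using K[of "\<bar>g (pi/2)\<bar> + C * (pi / 2)"] by (simp add: add.commute)
  qed
qed

section \<open>Sine moments in closed form\<close>

definition sin_moment :: "nat \<Rightarrow> nat \<Rightarrow> real" where
  "sin_moment n k = integral {0..pi/2} (\<lambda>x. x ^ (2 * n) / fact (2 * n) * sin (2 * real k * x))"

lemma sin_moment_has_integral:
  "((\<lambda>x. x ^ (2 * n) / fact (2 * n) * sin (2 * real k * x)) has_integral sin_moment n k) {0..pi/2}"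
  unfolding sin_moment_def
  by (intro integrable_integral integrable_continuous_real continuous_intros) auto

text \<open>The finite expansion of \<open>cot\<close>, integrated against the weight, writes the
  integral as a partial sum plus a remainder that tends to 0 by Riemann-Lebesgue.\<close>

lemma sin_moment_sums_integral_cot:
  "(\<lambda>k. 2 * sin_moment (Suc n) (Suc k)) sums
     integral {0..pi/2} (\<lambda>x. x ^ (2 * Suc n) / fact (2 * Suc n) * cot x)"
proof -
  define e :: "real \<Rightarrow> real" where "e x = x ^ (2 * Suc n) / fact (2 * Suc n)" for x
  define r where "r N x = x ^ (2 * n + 2) / sin x * cos ((2 * real N + 1) * x)" for N and x :: real
  have rI: "(r N has_integral integral {0..pi/2} (r N)) {0..pi/2}" for N
    unfolding r_def
    by (intro integrable_integral integrable_continuous_real continuous_intros continuous_on_power_div_sin)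
  have I: "((\<lambda>x. e x * cot x) has_integral
     (\<Sum>k<N. 2 * sin_moment (Suc n) (Suc k)) + integral {0..pi/2} (r N) / fact (2 * Suc n)) {0..pi/2}" for N
  proof -
    have "((\<lambda>x. (\<Sum>k<N. 2 * (e x * sin (2 * real (Suc k) * x))) + r N x / fact (2 * Suc n)) has_integral
     (\<Sum>k<N. 2 * sin_moment (Suc n) (Suc k)) + integral {0..pi/2} (r N) / fact (2 * Suc n)) {0..pi/2}"
      unfolding e_def
      by (intro has_integral_add has_integral_sum has_integral_mult_right sin_moment_has_integral
           has_integral_divide rI) auto
    moreover have "(\<Sum>k<N. 2 * (e x * sin (2 * real (Suc k) * x))) + r N x / fact (2 * Suc n) = e x * cot x"
      if x: "x \<in> {0..pi/2}" for x
    proof (cases "x = 0")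
      case False
      hence "sin x \<noteq> 0" using x pi_gt_zero by (intro less_imp_neq[symmetric] sin_gt_zero) auto
      from cot_eq_sum_sin[OF this, of N] show ?thesis
        by (simp add: e_def r_def distrib_left sum_distrib_left sum_divide_distrib mult_ac del: fact_Suc of_nat_Suc)
    qed (simp add: e_def r_def)
    ultimately show ?thesis by (rule has_integral_eq[rotated]) auto
  qed
  have "integral {0..pi/2} (\<lambda>x. e x * cot x) - integral {0..pi/2} (r N) / fact (2 * Suc n)
    = (\<Sum>k<N. 2 * sin_moment (Suc n) (Suc k))" for N
    unfolding integral_unique[OF I[of N]] by simp
  moreover have "(\<lambda>N. integral {0..pi/2} (\<lambda>x. e x * cot x) - integral {0..pi/2} (r N) / fact (2 * Suc n))
    \<longlonglongrightarrow> integral {0..pi/2} (\<lambda>x. e x * cot x) - 0 / fact (2 * Suc n)"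
    unfolding r_def
    by (intro tendsto_diff tendsto_divide tendsto_const integral_power_div_sin_cos_tendsto_0) simp
  ultimately show ?thesis by (simp add: sums_def e_def)
qed

text \<open>Two integrations by parts. The boundary contributes only through the cosine at
  \<open>pi / 2\<close>, where the phase is \<open>k pi\<close>.\<close>

lemma sin_moment_Suc:
  assumes "0 < k"
  shows "sin_moment (Suc n) k = (pi / 2) ^ (2 * Suc n) / fact (2 * Suc n) * ((-1) ^ (k + 1) / (2 * real k))
    - sin_moment n k / (2 * real k)\<^sup>2"
proof -
  define e where "e m x = x ^ m / fact m" for m and x :: real
  have de: "(e (Suc m) has_real_derivative e m x) (at x within S)" for m x S
    unfolding e_def by (rule has_real_derivative_power_Suc_div_fact)
  define q where "q = 2 * real k"
  have q: "0 < q" using assms by (simp add: q_def)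
  \<comment> \<open>Naming the reciprocals, with the cancellation rules below, keeps the derivative
    check free of division.\<close>
  define a b where "a = 1 / q" and "b = 1 / q\<^sup>2"
  have ab: "q * (a * z) = z" "q * (b * z) = a * z" "a * (q * z) = z" "b * (q * z) = a * z" for z
    using q by (simp_all add: a_def b_def power2_eq_square)
  define H where "H x = e (2*n+1) x * (b * sin (q * x)) - e (2*n+2) x * (a * cos (q * x))" for x
  define h where "h x = e (2*n+2) x * sin (q * x) + e (2*n) x * sin (q * x) / q\<^sup>2" for x
  have "(H has_real_derivative h x) (at x within {0..pi/2})" for x
  proof -
    have 1: "(e (2*n+2) has_real_derivative e (2*n+1) x) (at x within {0..pi/2})"
      and 2: "(e (2*n+1) has_real_derivative e (2*n) x) (at x within {0..pi/2})"
      using de[of "2*n+1"] de[of "2*n"] by auto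
    show ?thesis unfolding H_def h_def
      apply (rule derivative_eq_intros 1 2 refl)+
      apply (simp add: algebra_simps ab)
      apply (simp add: b_def)
      done
  qed
  hence I: "(h has_integral (H (pi/2) - H 0)) {0..pi/2}"
    by (intro fundamental_theorem_of_calculus) (auto simp: has_real_derivative_iff_has_vector_derivative)
  have J: "(h has_integral (sin_moment (Suc n) k + sin_moment n k / q\<^sup>2)) {0..pi/2}"
    using sin_moment_has_integral[of "Suc n" k] sin_moment_has_integral[of n k]
    unfolding h_def e_def q_def by (intro has_integral_add has_integral_divide) (simp_all only: mult_Suc_right add.commute)
  have "q * (pi / 2) = real k * pi" by (simp add: q_def)
  hence "H (pi/2) - H 0 = - (e (2*n+2) (pi/2) * ((-1) ^ k / q))"
    by (simp add: H_def e_def a_def)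
  with has_integral_unique[OF I J]
  have "sin_moment (Suc n) k = e (2 * n + 2) (pi/2) * ((-1) ^ (k + 1) / q) - sin_moment n k / q\<^sup>2"
    by simp
  thus ?thesis unfolding e_def q_def by (simp only: mult_Suc_right add.commute)
qed

lemma sin_moment_0:
  assumes "0 < k"
  shows "sin_moment 0 k = (1 - (-1) ^ k) / (2 * real k)"
proof -
  define q where "q = 2 * real k"
  have q: "0 < q" using assms by (simp add: q_def)
  have "((\<lambda>x. sin (q * x)) has_integral (- (cos (q * (pi/2)) / q) - - (cos (q * 0) / q))) {0..pi/2}"
    using q by (intro fundamental_theorem_of_calculus)
       (auto simp: has_real_derivative_iff_has_vector_derivative[symmetric] intro!: derivative_eq_intros)
  moreover have "((\<lambda>x. sin (q * x)) has_integral sin_moment 0 k) {0..pi/2}"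
    using sin_moment_has_integral[of 0 k] by (simp add: q_def)
  ultimately have "sin_moment 0 k = - (cos (q * (pi/2)) / q) - - (cos (q * 0) / q)"
    by (rule has_integral_unique[rotated])
  moreover have "q * (pi / 2) = real k * pi" by (simp add: q_def)
  ultimately show ?thesis by (simp add: q_def diff_divide_distrib)
qed

text \<open>The recursion unrolled down to \<open>sin_moment 0 k\<close>. Summed over
  \<open>k\<close>, the boundary terms yield alternating zeta values, and the last term yields a sum
  over odd \<open>k\<close>.\<close>

lemma sin_moment_eq:
  assumes "0 < k"
  shows "sin_moment n k =
    (\<Sum>r<n. (-1) ^ r * ((pi / 2) ^ (2 * (n - r)) / fact (2 * (n - r))) * ((-1) ^ (k + 1) / (2 * real k) ^ (2 * r + 1)))
      + (-1) ^ n * ((1 - (-1) ^ k) / (2 * real k) ^ (2 * n + 1))"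
proof (induction n)
  case 0
  show ?case using sin_moment_0[OF assms] by simp
next
  case (Suc n)
  define q where "q = 2 * real k"
  have q: "0 < q" using assms by (simp add: q_def)
  define F where "F n r = (-1) ^ r * ((pi / 2) ^ (2 * (n - r)) / fact (2 * (n - r))) * ((-1) ^ (k + 1) / q ^ (2 * r + 1))" for n r
  \<comment> \<open>One step of the recursion moves the boundary term \<open>r\<close> of level
    \<open>n\<close> to position \<open>r + 1\<close> of the next level.\<close>
  have F: "F (Suc n) (Suc r) = (- 1 / q\<^sup>2) * F n r" for r
    by (simp add: F_def power2_eq_square)
  have "sin_moment (Suc n) k = F (Suc n) 0 + (- 1 / q\<^sup>2) * sin_moment n k"
    unfolding sin_moment_Suc[OF assms] by (simp add: F_def q_def del: fact_Suc)
  also have "(- 1 / q\<^sup>2) * sin_moment n k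
      = (\<Sum>r<n. F (Suc n) (Suc r)) + (- 1 / q\<^sup>2) * ((-1) ^ n * ((1 - (-1) ^ k) / q ^ (2 * n + 1)))"
    unfolding Suc.IH F by (simp only: F_def q_def sum_distrib_left distrib_left)
  also have "(- 1 / q\<^sup>2) * ((-1) ^ n * ((1 - (-1) ^ k) / q ^ (2 * n + 1)))
      = (-1) ^ Suc n * ((1 - (-1) ^ k) / q ^ (2 * Suc n + 1))"
    by (simp add: power2_eq_square)
  finally show ?case
    unfolding sum.lessThan_Suc_shift by (simp only: F_def q_def add.assoc)
qed

section \<open>Alternating and odd zeta series\<close>

lemma summable_alternating_inverse_power:
  assumes "0 < m"
  shows "summable (\<lambda>j. (-1) ^ j / real (Suc j) ^ m)"
proof -
  have "summable (\<lambda>j. (-1) ^ j * (1 / real (Suc j) ^ m))"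
  proof (rule summable_Leibniz(1))
    have "(\<lambda>j. (1 / real (Suc j)) ^ m) \<longlonglongrightarrow> 0 ^ m"
      using LIMSEQ_inverse_real_of_nat by (intro tendsto_power) (simp add: inverse_eq_divide)
    thus "(\<lambda>j. 1 / real (Suc j) ^ m) \<longlonglongrightarrow> 0" using assms by (simp add: power_divide zero_power)
    have "1 / real (Suc j) ^ m \<le> 1 / real (Suc i) ^ m" if "i \<le> j" for i j
      using that by (intro divide_left_mono power_mono mult_pos_pos) auto
    thus "monoseq (\<lambda>j. 1 / real (Suc j) ^ m)" by (auto intro!: monoI2)
  qed
  thus ?thesis by simp
qed

lemma uminus_zeta_bar_sums:
  assumes "0 < m"
  shows "(\<lambda>j. (-1) ^ j / real (Suc j) ^ m) sums (- zeta_bar m)"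
proof -
  have "zeta_bar m = (\<Sum>j. - ((-1) ^ j / real (Suc j) ^ m))"
    by (simp add: zeta_bar_def)
  also have "\<dots> = - (\<Sum>j. (-1) ^ j / real (Suc j) ^ m)"
    by (rule suminf_minus[OF summable_alternating_inverse_power[OF assms]])
  finally show ?thesis using summable_sums[OF summable_alternating_inverse_power[OF assms]] by simp
qed

lemma zeta_val_sums:
  assumes "2 \<le> m"
  shows "(\<lambda>j. 1 / real (Suc j) ^ m) sums zeta_val m"
proof -
  have "summable (\<lambda>j. inverse (real j ^ m))" by (rule inverse_power_summable[OF assms])
  hence "summable (\<lambda>j. inverse (real (Suc j) ^ m))" by (subst summable_Suc_iff)
  thus ?thesis unfolding zeta_val_def by (simp add: inverse_eq_divide summable_sums)
qed

text \<open>The numerator is 2 at odd and 0 at even \<open>j + 1\<close>, so this is twice the zeta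
  series without its even part, which is \<open>zeta_val m / 2 ^ m\<close>.\<close>

lemma odd_zeta_sums:
  assumes "2 \<le> m"
  shows "(\<lambda>j. (1 - (-1) ^ Suc j) / real (Suc j) ^ m) sums (2 * (1 - 1 / 2 ^ m) * zeta_val m)"
proof -
  \<comment> \<open>Twice the even part; it lives on the indices \<open>2 i + 1\<close>, where the
    shifted denominator is \<open>2 (i + 1)\<close>.\<close>
  define f where "f j = (1 + (-1) ^ Suc j) / real (Suc j) ^ m" for j
  have "(\<lambda>j. f (2 * j + 1)) sums (2 / 2 ^ m * zeta_val m)"
  proof -
    have "f (2 * j + 1) = 2 / 2 ^ m * (1 / real (Suc j) ^ m)" for j
      by (simp add: f_def flip: power_mult_distrib)
    thus ?thesis using sums_mult[OF zeta_val_sums[OF assms]] by presburger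
  qed
  moreover have "f j = 0" if "j \<notin> range (\<lambda>j. 2 * j + 1)" for j
  proof -
    have "even j" using that by (metis oddE rangeI)
    thus ?thesis by (simp add: f_def)
  qed
  ultimately have "f sums (2 / 2 ^ m * zeta_val m)"
    by (subst (asm) sums_mono_reindex) (auto simp: strict_mono_def)
  hence "(\<lambda>j. 2 * (1 / real (Suc j) ^ m) - f j) sums (2 * zeta_val m - 2 / 2 ^ m * zeta_val m)"
    by (intro sums_diff sums_mult zeta_val_sums assms)
  thus ?thesis by (simp add: f_def add_divide_distrib diff_divide_distrib algebra_simps)
qed

section \<open>Summation of the sine moments over all frequencies\<close>

theorem mainTheorem4:
  fixes n :: nat
  assumes "n \<ge> 1"
  shows "multiple_t (1 # replicate n 2) =
    1 / 2 ^ (2 * n) *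
      ((\<Sum>r = 0..n - 1. (-1) ^ r * (- zeta_bar (2 * r + 1)) *
          (pi ^ (2 * (n - r)) / fact (2 * (n - r))))
       + (-1) ^ n * 2 * (1 - 1 / 2 ^ (2 * n + 1)) * zeta_val (2 * n + 1))"
proof -
  \<comment> \<open>Coefficient of the alternating series of exponent \<open>2 r + 1\<close> in
    \<open>2 * sin_moment n k\<close>; the factor 2 cancels one of the \<open>2 r + 1\<close> twos
    in \<open>(2 k) ^ (2 r + 1)\<close>.\<close>
  define c where "c r = (-1) ^ r * ((pi / 2) ^ (2 * (n - r)) / fact (2 * (n - r))) / 2 ^ (2 * r)" for r
  define Z where "Z = 2 * (1 - 1 / 2 ^ (2 * n + 1)) * zeta_val (2 * n + 1)"
  obtain n' where n': "n = Suc n'" using assms by (cases n) auto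
  \<comment> \<open>For \<open>r = 0\<close> the series converges only conditionally, so the finite
    sum over \<open>r\<close> is combined termwise in \<open>j\<close> by linearity of ordered
    series.\<close>
  have "(\<lambda>j. (\<Sum>r<n. c r * ((-1) ^ j / real (Suc j) ^ (2 * r + 1)))
      + (-1) ^ n / 2 ^ (2 * n) * ((1 - (-1) ^ Suc j) / real (Suc j) ^ (2 * n + 1)))
    sums ((\<Sum>r<n. c r * (- zeta_bar (2 * r + 1))) + (-1) ^ n / 2 ^ (2 * n) * Z)"
    unfolding Z_def using assms
    by (intro sums_add sums_sum sums_mult uminus_zeta_bar_sums odd_zeta_sums) auto
  also have "(\<lambda>j. (\<Sum>r<n. c r * ((-1) ^ j / real (Suc j) ^ (2 * r + 1)))
      + (-1) ^ n / 2 ^ (2 * n) * ((1 - (-1) ^ Suc j) / real (Suc j) ^ (2 * n + 1)))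
    = (\<lambda>j. 2 * sin_moment n (Suc j))"
  proof
    fix j
    show "(\<Sum>r<n. c r * ((-1) ^ j / real (Suc j) ^ (2 * r + 1)))
      + (-1) ^ n / 2 ^ (2 * n) * ((1 - (-1) ^ Suc j) / real (Suc j) ^ (2 * n + 1)) = 2 * sin_moment n (Suc j)"
      unfolding sin_moment_eq[OF zero_less_Suc] distrib_left sum_distrib_left c_def
      by (intro arg_cong2[of _ _ _ _ "(+)"] sum.cong refl)
         (simp_all add: power_mult_distrib mult_ac del: of_nat_Suc)
  qed
  finally have "multiple_t (1 # replicate n 2) = (\<Sum>r<n. c r * (- zeta_bar (2 * r + 1))) + (-1) ^ n / 2 ^ (2 * n) * Z"
    unfolding n' multiple_t_1_twos_eq_integral_cot
    by (rule sums_unique2[OF sin_moment_sums_integral_cot])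
  \<comment> \<open>The powers of 2 in \<open>(pi / 2) ^ (2 (n - r))\<close> and
    \<open>2 ^ (2 r)\<close> combine to \<open>2 ^ (2 n)\<close>, independent of
    \<open>r\<close>.\<close>
  also have "(\<Sum>r<n. c r * (- zeta_bar (2 * r + 1)))
    = (\<Sum>r<n. 1 / 2 ^ (2 * n) * ((-1) ^ r * (- zeta_bar (2 * r + 1)) * (pi ^ (2 * (n - r)) / fact (2 * (n - r)))))"
  proof (rule sum.cong[OF refl])
    fix r assume "r \<in> {..<n}"
    hence "(2::real) ^ (2 * n) = 2 ^ (2 * (n - r)) * 2 ^ (2 * r)"
      by (simp flip: power_add)
    thus "c r * (- zeta_bar (2 * r + 1))
      = 1 / 2 ^ (2 * n) * ((-1) ^ r * (- zeta_bar (2 * r + 1)) * (pi ^ (2 * (n - r)) / fact (2 * (n - r))))"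
      by (simp add: c_def power_divide mult_ac)
  qed
  also have "{..<n} = {0..n - 1}" using assms by auto
  also have "(-1) ^ n / 2 ^ (2 * n) * Z
    = 1 / 2 ^ (2 * n) * ((-1) ^ n * 2 * (1 - 1 / 2 ^ (2 * n + 1)) * zeta_val (2 * n + 1))"
    by (simp add: Z_def mult.assoc)
  finally show ?thesis unfolding distrib_left sum_distrib_left .
qed

end
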